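(* Let $M$ be a nilpotent simple rank-three matroid on $[d]$. Let $w=(p_1,\dots,p_d)$ be an ordering of its points such that $w_i\le1$ for all $i\in[d]$, where $w_i$ is the degree of $p_i$ in the restriction $M|\{p_1,\dots,p_i\}$. Let $\gamma\in V_{\mathcal{C}(M)}$ have no loops and no coinciding points, i.e. the $\gamma_i$ are nonzero and pairwise linearly independent. Let $q\in\mathbb{C}^3$ be in general position with respect to $\gamma$. Then \[ \dim \mathrm{Lift}_{M,q}(\gamma)=d-\sum_{i=1}^d w_i. \]
   Context: Circuit variety: $V_{\mathcal{C}(M)}\subseteq\mathbb{C}^{3d}$ is the set of families $\gamma=(\gamma_1,\dots,\gamma_d)$ of vectors in $\mathbb{C}^3$ such that $\{\gamma_i:i\in S\}$ is linearly dependent for every dependent set $S$ of $M$. Lines and degrees: - A line of a simple rank-three matroid is a maximal subset with at least three elements all of whose $3$-subsets are dependent. - The degree of a point is the number of lines containing it. Nilpotent matroids: $S_M$ is the set of points of degree at least $2$; $M_1=M|S_M$ and $M_{j+1}=M|S_{M_j}$. $M$ is nilpotent if some $M_j$ is empty. Lifting space: $\mathrm{Lift}_{M,q}(\gamma)\subseteq\mathbb{C}^d$ is the linear subspace of all $(z_1,\dots,z_d)$ such that $(\gamma_1+z_1q,\dots,\gamma_d+z_dq)\in V_{\mathcal{C}(M)}$. *)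

theory Defs
  imports "HOL-Analysis.Analysis"
begin

section \<open>Matroids\<close>

record 'a set_system =
  ground :: "'a set"
  indep :: "'a set \<Rightarrow> bool"

definition matroid :: "'a set_system \<Rightarrow> bool" where
  "matroid M \<longleftrightarrow>
     finite (ground M) \<and>
     (\<forall>X. indep M X \<longrightarrow> X \<subseteq> ground M) \<and>
     indep M {} \<and>
     (\<forall>X Y. indep M X \<and> Y \<subseteq> X \<longrightarrow> indep M Y) \<and>
     (\<forall>X Y. indep M X \<and> indep M Y \<and> card X < card Y \<longrightarrow>
        (\<exists>y\<in>Y - X. indep M (insert y X)))"

definition dependent_set :: "'a set_system \<Rightarrow> 'a set \<Rightarrow> bool" where
  "dependent_set M X \<longleftrightarrow> X \<subseteq> ground M \<and> \<not> indep M X"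

definition matroid_rank :: "'a set_system \<Rightarrow> nat" where
  "matroid_rank M = Max (card ` {X. indep M X})"

text \<open>No loops and no parallel elements.\<close>

definition simple_matroid :: "'a set_system \<Rightarrow> bool" where
  "simple_matroid M \<longleftrightarrow>
     matroid M \<and> (\<forall>X. dependent_set M X \<longrightarrow> card X > 2)"

definition restrict_matroid :: "'a set_system \<Rightarrow> 'a set \<Rightarrow> 'a set_system" where
  "restrict_matroid M S =
     \<lparr>ground = ground M \<inter> S, indep = (\<lambda>X. indep M X \<and> X \<subseteq> S)\<rparr>"

section \<open>Lines, degrees and nilpotency\<close>

text \<open>The definitions below are stated for arbitrary set systems because they are also applied to
  restrictions of a simple rank-three matroid, whose rank may be smaller. In a restriction of rank
  two with at least three points, the whole ground set is a line.\<close>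

definition collinear_set :: "'a set_system \<Rightarrow> 'a set \<Rightarrow> bool" where
  "collinear_set M L \<longleftrightarrow>
     L \<subseteq> ground M \<and> card L \<ge> 3 \<and> (\<forall>X \<subseteq> L. card X = 3 \<longrightarrow> dependent_set M X)"

definition is_line :: "'a set_system \<Rightarrow> 'a set \<Rightarrow> bool" where
  "is_line M L \<longleftrightarrow>
     collinear_set M L \<and> (\<forall>L'. collinear_set M L' \<and> L \<subseteq> L' \<longrightarrow> L' = L)"

definition point_degree :: "'a set_system \<Rightarrow> 'a \<Rightarrow> nat" where
  "point_degree M x = card {L. is_line M L \<and> x \<in> L}"

definition multi_points :: "'a set_system \<Rightarrow> 'a set" where
  "multi_points M = {x \<in> ground M. point_degree M x \<ge> 2}"

definition nilpotent_matroid :: "'a set_system \<Rightarrow> bool" where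
  "nilpotent_matroid M \<longleftrightarrow>
     (\<exists>j. ground (((\<lambda>N. restrict_matroid N (multi_points N)) ^^ j) M) = {})"

text \<open>For an ordering \<open>p 1, p 2, \<dots>\<close> of the points, this is the degree of the
  \<open>i\<close>-th point in the restriction to the first \<open>i\<close> points.\<close>

definition order_degree :: "'a set_system \<Rightarrow> (nat \<Rightarrow> 'a) \<Rightarrow> nat \<Rightarrow> nat" where
  "order_degree M p i = point_degree (restrict_matroid M (p ` {1..i})) (p i)"

section \<open>Circuit variety and lifting space\<close>

text \<open>A finite type \<open>'n\<close> plays the role of the index set of \<open>d = CARD('n)\<close> elements, so a
  family of \<open>d\<close> vectors has type \<open>complex ^ 3 ^ 'n\<close>. All linear algebra is over the complex
  numbers: the constants qualified by \<open>vec\<close> refer to the scalar multiplication \<open>*s\<close>, whereas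
  their unqualified counterparts refer to the underlying real vector space.\<close>

text \<open>Linear dependence of the family indexed by \<open>S\<close>, so that a repeated vector counts as a
  dependency. This is why it is not expressed by the dependence of the image of \<open>S\<close>.\<close>

definition lin_dep_family :: "complex ^ 3 ^ 'n::finite \<Rightarrow> 'n set \<Rightarrow> bool" where
  "lin_dep_family \<gamma> S \<longleftrightarrow>
     (\<exists>c :: 'n \<Rightarrow> complex. (\<exists>i\<in>S. c i \<noteq> 0) \<and> (\<Sum>i\<in>S. c i *s \<gamma> $ i) = 0)"

definition circuit_variety :: "'n::finite set_system \<Rightarrow> (complex ^ 3 ^ 'n) set" where
  "circuit_variety M = {\<gamma>. \<forall>S. dependent_set M S \<longrightarrow> lin_dep_family \<gamma> S}"

text \<open>The vector \<open>q\<close> avoids every proper subspace spanned by some of the vectors of the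
  family (in particular every plane spanned by two of them).\<close>

definition general_position :: "complex ^ 3 ^ 'n::finite \<Rightarrow> complex ^ 3 \<Rightarrow> bool" where
  "general_position \<gamma> q \<longleftrightarrow>
     (\<forall>S. vec.span ((\<lambda>i. \<gamma> $ i) ` S) \<noteq> UNIV \<longrightarrow> q \<notin> vec.span ((\<lambda>i. \<gamma> $ i) ` S))"

definition Lift ::
  "'n::finite set_system \<Rightarrow> complex ^ 3 \<Rightarrow> complex ^ 3 ^ 'n \<Rightarrow> (complex ^ 'n) set" where
  "Lift M q \<gamma> = {z. (\<chi> i. \<gamma> $ i + z $ i *s q) \<in> circuit_variety M}"

section \<open>The lifting space is a linear subspace\<close>

text \<open>Hence \<open>vec.dim\<close>, which is defined for arbitrary sets as the dimension of their span, is
  the dimension of the lifting space itself.\<close>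

lemma lin_dep_family_large:
  fixes \<gamma> :: "complex ^ 3 ^ 'n::finite"
  assumes "card S > 3"
  shows "lin_dep_family \<gamma> S"
proof (cases "inj_on (\<lambda>i. \<gamma> $ i) S")
  case True
  let ?g = "\<lambda>i. \<gamma> $ i"
  have "card (?g ` S) > 3"
    using assms True by (simp add: card_image)
  moreover have "vec.dim (UNIV :: (complex ^ 3) set) = 3"
    by (simp add: vec.dim_UNIV vec.dimension_def card_cart_basis)
  then have "vec.dim (?g ` S) \<le> 3"
    by (metis vec.dim_subset subset_UNIV)
  ultimately have "vec.dependent (?g ` S)"
    using vec.dependent_biggerset_general by (metis order_le_less_trans)
  then obtain u v where uv: "v \<in> ?g ` S" "u v \<noteq> 0" "(\<Sum>v\<in>?g ` S. u v *s v) = 0"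
    using vec.dependent_finite[of "?g ` S"] by auto
  have "(\<Sum>i\<in>S. u (?g i) *s ?g i) = 0"
    using uv(3) by (simp add: sum.reindex[OF True])
  with uv(1,2) show ?thesis
    unfolding lin_dep_family_def by (intro exI[of _ "\<lambda>i. u (?g i)"]) auto
next
  case False
  then obtain a b where ab: "a \<in> S" "b \<in> S" "a \<noteq> b" "\<gamma> $ a = \<gamma> $ b"
    by (auto simp: inj_on_def)
  define c :: "'n \<Rightarrow> complex" where "c = (\<lambda>i. if i = a then 1 else if i = b then -1 else 0)"
  have "(\<Sum>i\<in>S. c i *s \<gamma> $ i) = (\<Sum>i\<in>{a, b}. c i *s \<gamma> $ i)"
    by (rule sum.mono_neutral_right) (use ab in \<open>auto simp: c_def\<close>)
  also have "\<dots> = 0"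
    using ab by (simp add: c_def)
  finally show ?thesis
    unfolding lin_dep_family_def using ab(1) by (intro exI[of _ c]) (auto simp: c_def)
qed

lemma exists_3: "(\<exists>i :: 3. P i) \<longleftrightarrow> P 1 \<or> P 2 \<or> P 3"
  by (metis exhaust_3)

lemma lin_dep_family_det:
  fixes \<gamma> :: "complex ^ 3 ^ 'n::finite"
  assumes "a \<noteq> b" "a \<noteq> c" "b \<noteq> c"
  shows "lin_dep_family \<gamma> {a, b, c} \<longleftrightarrow> det (vector [\<gamma> $ a, \<gamma> $ b, \<gamma> $ c]) = 0"
proof -
  let ?A = "vector [\<gamma> $ a, \<gamma> $ b, \<gamma> $ c] :: complex ^ 3 ^ 3"
  have rows: "row 1 ?A = \<gamma> $ a" "row 2 ?A = \<gamma> $ b" "row 3 ?A = \<gamma> $ c"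
    by (simp_all add: row_def vec_eq_iff)
  have "det ?A = 0 \<longleftrightarrow>
      (\<exists>k :: 3 \<Rightarrow> complex. (\<exists>i. k i \<noteq> 0) \<and> k 1 *s \<gamma> $ a + k 2 *s \<gamma> $ b + k 3 *s \<gamma> $ c = 0)"
    using invertible_det_nz[of ?A] invertible_right_inverse[of ?A]
      matrix_right_invertible_independent_rows[of ?A]
    by (auto simp: sum_3 rows)
  also have "\<dots> \<longleftrightarrow> lin_dep_family \<gamma> {a, b, c}" (is "?L \<longleftrightarrow> ?R")
  proof
    assume ?L
    then obtain k :: "3 \<Rightarrow> complex"
      where k: "\<exists>i. k i \<noteq> 0" "k 1 *s \<gamma> $ a + k 2 *s \<gamma> $ b + k 3 *s \<gamma> $ c = 0"
      by blast
    then show ?R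
      unfolding lin_dep_family_def using assms
      by (intro exI[of _ "\<lambda>i. if i = a then k 1 else if i = b then k 2 else k 3"])
        (auto simp: exists_3 add.assoc)
  next
    assume ?R
    then obtain k where k: "\<exists>i\<in>{a, b, c}. k i \<noteq> 0" "(\<Sum>i\<in>{a, b, c}. k i *s \<gamma> $ i) = 0"
      unfolding lin_dep_family_def by blast
    then show ?L
      using assms
      by (intro exI[of _ "\<lambda>i :: 3. if i = 1 then k a else if i = 2 then k b else k c"])
        (auto simp: exists_3 add.assoc)
  qed
  finally show ?thesis by simp
qed

proposition subspace_Lift:
  fixes M :: "'n::finite set_system"
  assumes "simple_matroid M" "\<gamma> \<in> circuit_variety M"
  shows "vec.subspace (Lift M q \<gamma>)"
proof -
  define T where "T = {(a, b, c). a \<noteq> b \<and> a \<noteq> c \<and> b \<noteq> c \<and> dependent_set M {a, b, c}}"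
  have char: "\<delta> \<in> circuit_variety M \<longleftrightarrow>
      (\<forall>(a, b, c) \<in> T. det (vector [\<delta> $ a, \<delta> $ b, \<delta> $ c]) = 0)" for \<delta> :: "complex ^ 3 ^ 'n"
  proof
    assume "\<delta> \<in> circuit_variety M"
    then show "\<forall>(a, b, c) \<in> T. det (vector [\<delta> $ a, \<delta> $ b, \<delta> $ c]) = 0"
      by (auto simp: T_def circuit_variety_def simp flip: lin_dep_family_det)
  next
    assume T: "\<forall>(a, b, c) \<in> T. det (vector [\<delta> $ a, \<delta> $ b, \<delta> $ c]) = 0"
    have "lin_dep_family \<delta> S" if S: "dependent_set M S" for S
    proof (cases "card S = 3")
      case True
      then obtain a b c where abc: "S = {a, b, c}" "a \<noteq> b" "a \<noteq> c" "b \<noteq> c"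
        by (auto simp: card_3_iff)
      with S have "(a, b, c) \<in> T" by (simp add: T_def)
      with T abc show ?thesis by (auto simp: lin_dep_family_det)
    next
      case False
      with S assms(1) have "card S > 3" by (fastforce simp: simple_matroid_def)
      then show ?thesis by (rule lin_dep_family_large)
    qed
    then show "\<delta> \<in> circuit_variety M" by (simp add: circuit_variety_def)
  qed
  define l where "l = (\<lambda>(a, b, c) z. z $ a * det (vector [q, \<gamma> $ b, \<gamma> $ c] :: complex ^ 3 ^ 3)
    + z $ b * det (vector [\<gamma> $ a, q, \<gamma> $ c] :: complex ^ 3 ^ 3)
    + z $ c * det (vector [\<gamma> $ a, \<gamma> $ b, q] :: complex ^ 3 ^ 3))"
  have expand: "det (vector [\<gamma> $ a + z $ a *s q, \<gamma> $ b + z $ b *s q, \<gamma> $ c + z $ c *s q]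
      :: complex ^ 3 ^ 3) = det (vector [\<gamma> $ a, \<gamma> $ b, \<gamma> $ c] :: complex ^ 3 ^ 3) + l (a, b, c) z"
    for a b c and z :: "complex ^ 'n"
    by (simp add: l_def det_3 algebra_simps)
  have "z \<in> Lift M q \<gamma> \<longleftrightarrow> (\<forall>t\<in>T. l t z = 0)" for z
  proof -
    have "det (vector [\<gamma> $ a, \<gamma> $ b, \<gamma> $ c] :: complex ^ 3 ^ 3) = 0" if "(a, b, c) \<in> T" for a b c
      using assms(2) that unfolding char by auto
    then show ?thesis
      by (auto simp: Lift_def char expand)
  qed
  then have eq: "Lift M q \<gamma> = {z. \<forall>t\<in>T. l t z = 0}" by blast
  have l0: "l t 0 = 0" for t
    by (cases t) (simp add: l_def)
  have ladd: "l t (x + y) = l t x + l t y" for t x y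
    by (cases t) (simp add: l_def algebra_simps)
  have lsc: "l t (k *s x) = k * l t x" for t k x
    by (cases t) (simp add: l_def algebra_simps)
  show ?thesis
    unfolding eq vec.subspace_def by (simp add: l0 ladd lsc)
qed

end

theory Submission
  imports Defs
begin

text \<open>Insert the points one at a time. Lifting a point that lies on no line so far imposes no condition;
  lifting a point on exactly one line determines its coordinate from those of two other points
  \<open>a\<close>, \<open>b\<close> of the line. The remaining conditions on that line follow, because the lifts
  of \<open>a\<close> and \<open>b\<close> stay linearly independent and hence all lifted points of
  the line lie in the plane spanned by them. So each step lowers the dimension by the degree of
  the inserted point.\<close>

section \<open>Linear dependence of indexed families\<close>

lemma lin_dep_family_iff:
  fixes \<gamma> :: "complex ^ 3 ^ 'n::finite"
  shows "lin_dep_family \<gamma> S \<longleftrightarrow> \<not> inj_on (($) \<gamma>) S \<or> vec.dependent (($) \<gamma> ` S)"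
proof (cases "inj_on (($) \<gamma>) S")
  case True
  show ?thesis
  proof
    assume "lin_dep_family \<gamma> S"
    then obtain c i where c: "i \<in> S" "c i \<noteq> 0" "(\<Sum>i\<in>S. c i *s \<gamma> $ i) = 0"
      unfolding lin_dep_family_def by blast
    define u where "u = c \<circ> the_inv_into S (($) \<gamma>)"
    have u: "u (\<gamma> $ i) = c i" if "i \<in> S" for i
      using that True by (simp add: u_def the_inv_into_f_f)
    have "(\<Sum>v\<in>($) \<gamma> ` S. u v *s v) = 0"
      using c(3) by (simp add: sum.reindex[OF True] u)
    moreover have "u (\<gamma> $ i) \<noteq> 0" using c u by simp
    ultimately show "\<not> inj_on (($) \<gamma>) S \<or> vec.dependent (($) \<gamma> ` S)"
      using c(1) by (auto simp: vec.dependent_finite)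
  next
    assume "\<not> inj_on (($) \<gamma>) S \<or> vec.dependent (($) \<gamma> ` S)"
    with True obtain u v where "v \<in> ($) \<gamma> ` S" "u v \<noteq> 0" "(\<Sum>v\<in>($) \<gamma> ` S. u v *s v) = 0"
      by (auto simp: vec.dependent_finite)
    then show "lin_dep_family \<gamma> S"
      unfolding lin_dep_family_def
      by (intro exI[of _ "\<lambda>i. u (\<gamma> $ i)"]) (auto simp: sum.reindex[OF True])
  qed
next
  case False
  then obtain a b where ab: "a \<in> S" "b \<in> S" "a \<noteq> b" "\<gamma> $ a = \<gamma> $ b"
    by (auto simp: inj_on_def)
  \<comment> \<open>The relation \<gamma>_a - \<gamma>_b = 0, written as a difference of indicators
    so that each sum over \<open>S\<close> collapses to a single term.\<close>
  define c :: "'n \<Rightarrow> complex" where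
    "c = (\<lambda>i. (if i = a then 1 else 0) - (if i = b then 1 else 0))"
  have "(\<Sum>i\<in>S. c i *s \<gamma> $ i) = \<gamma> $ a - \<gamma> $ b"
    using ab by (simp add: c_def vec.scale_left_diff_distrib sum_subtractf
        if_distrib[of "\<lambda>k. k *s _"] cong: if_cong)
  also have "\<dots> = 0"
    using ab by simp
  finally have "lin_dep_family \<gamma> S"
    unfolding lin_dep_family_def using ab(1,3) by (intro exI[of _ c]) (auto simp: c_def)
  with False show ?thesis by simp
qed

text \<open>By the exchange bound, an independent family in the span of \<open>B\<close> has at most
  \<open>card B\<close> members. Counting indices rather than vectors is harmless, since
  independence forces the vectors to be distinct.\<close>

lemma lin_dep_family_in_span:
  fixes \<gamma> :: "complex ^ 3 ^ 'n::finite"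
  assumes "finite B" "card B < card S" "\<And>i. i \<in> S \<Longrightarrow> \<gamma> $ i \<in> vec.span B"
  shows "lin_dep_family \<gamma> S"
proof (rule ccontr)
  assume "\<not> ?thesis"
  then have inj: "inj_on (($) \<gamma>) S" and ind: "vec.independent (($) \<gamma> ` S)"
    by (auto simp: lin_dep_family_iff)
  have "card (($) \<gamma> ` S) \<le> card B"
    using vec.independent_span_bound[OF assms(1) ind] assms(3) by blast
  with assms(2) show False by (simp add: card_image[OF inj])
qed

text \<open>A vector outside the span of an independent pair would extend it to an independent
  triple.\<close>

lemma lin_dep_family_triple_in_span:
  fixes \<gamma> :: "complex ^ 3 ^ 'n::finite"
  assumes "lin_dep_family \<gamma> {a, b, c}" "\<not> lin_dep_family \<gamma> {a, b}"
  shows "\<gamma> $ c \<in> vec.span {\<gamma> $ a, \<gamma> $ b}"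
proof (rule ccontr)
  assume c: "\<gamma> $ c \<notin> vec.span {\<gamma> $ a, \<gamma> $ b}"
  have inj: "inj_on (($) \<gamma>) {a, b}" and ind: "vec.independent {\<gamma> $ a, \<gamma> $ b}"
    using assms(2) unfolding lin_dep_family_iff
    by (simp_all only: image_insert image_empty simp_thms de_Morgan_disj)
  have "vec.independent (insert (\<gamma> $ c) {\<gamma> $ a, \<gamma> $ b})"
    using c ind by (rule vec.independent_insertI)
  then have "vec.independent (($) \<gamma> ` insert c {a, b})"
    by (simp only: image_insert image_empty not_False_eq_True)
  moreover have "\<gamma> $ c \<noteq> \<gamma> $ a" "\<gamma> $ c \<noteq> \<gamma> $ b"
    using c by (metis vec.span_base insertCI)+
  with inj have "inj_on (($) \<gamma>) (insert c {a, b})"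
    unfolding inj_on_insert by blast
  moreover have "insert c {a, b} = {a, b, c}" by blast
  ultimately show False
    using assms(1) unfolding lin_dep_family_iff by metis
qed

lemma lin_dep_family_cong:
  assumes "\<And>i. i \<in> S \<Longrightarrow> \<gamma> $ i = \<delta> $ i"
  shows "lin_dep_family \<gamma> S \<longleftrightarrow> lin_dep_family \<delta> S"
  using assms by (simp add: lin_dep_family_def)

lemma lin_dep_family_pair:
  assumes "a \<noteq> b"
  shows "lin_dep_family \<gamma> {a, b} \<longleftrightarrow>
    (\<exists>s t. (s \<noteq> 0 \<or> t \<noteq> 0) \<and> s *s \<gamma> $ a + t *s \<gamma> $ b = 0)"
proof
  assume "\<exists>s t. (s \<noteq> 0 \<or> t \<noteq> 0) \<and> s *s \<gamma> $ a + t *s \<gamma> $ b = 0"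
  then obtain s t where "s \<noteq> 0 \<or> t \<noteq> 0" "s *s \<gamma> $ a + t *s \<gamma> $ b = 0" by blast
  then show "lin_dep_family \<gamma> {a, b}"
    unfolding lin_dep_family_def
    using assms by (intro exI[of _ "\<lambda>i. if i = a then s else t"]) auto
qed (use assms in \<open>auto simp: lin_dep_family_def\<close>)

lemma span_pair_iff:
  "x \<in> vec.span {a, b} \<longleftrightarrow> (\<exists>s t. x = s *s a + t *s b)"
proof -
  have "x \<in> vec.span {a, b} \<longleftrightarrow> (\<exists>s t. x - s *s a - t *s b = 0)"
    by (auto simp: vec.span_breakdown_eq)
  then show ?thesis by (simp add: algebra_simps)
qed

section \<open>General position and lifted pairs\<close>

text \<open>Two vectors span at most a plane, which is proper in C^3, so general position applies to
  it.\<close>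

lemma general_position_pair:
  assumes "general_position \<gamma> q"
  shows "q \<notin> vec.span {\<gamma> $ a, \<gamma> $ b}"
proof -
  have "vec.dim {\<gamma> $ a, \<gamma> $ b} \<le> 2"
    using vec.dim_le_card'[of "{\<gamma> $ a, \<gamma> $ b}"] card_insert_le_m1[of 2 "{\<gamma> $ b}" "\<gamma> $ a"] by simp
  moreover have "vec.dim (UNIV :: (complex ^ 3) set) = 3"
    by (simp add: vec.dim_UNIV vec.dimension_def card_cart_basis)
  moreover have "vec.dim (vec.span {\<gamma> $ a, \<gamma> $ b}) = vec.dim {\<gamma> $ a, \<gamma> $ b}"
    by (rule vec.dim_span)
  ultimately have "vec.dim (vec.span {\<gamma> $ a, \<gamma> $ b}) \<noteq> vec.dim (UNIV :: (complex ^ 3) set)"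
    by linarith
  then have "vec.span {\<gamma> $ a, \<gamma> $ b} \<noteq> UNIV"
    by metis
  then show ?thesis
    using assms[unfolded general_position_def, rule_format, of "{a, b}"] by simp
qed

text \<open>A relation between the two lifts is a relation among \<open>\<gamma> $ a\<close>,
  \<open>\<gamma> $ b\<close> and \<open>q\<close>. If \<open>q\<close> drops out, it contradicts
  independence of the original pair; otherwise it can be solved for \<open>q\<close>, which lies
  outside their span.\<close>

lemma lifted_pair_independent:
  assumes "a \<noteq> b" "\<not> lin_dep_family \<gamma> {a, b}" "q \<notin> vec.span {\<gamma> $ a, \<gamma> $ b}"
  shows "\<not> lin_dep_family (\<chi> i. \<gamma> $ i + z $ i *s q) {a, b}"
proof
  assume "lin_dep_family (\<chi> i. \<gamma> $ i + z $ i *s q) {a, b}"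
  then obtain s t where st: "s \<noteq> 0 \<or> t \<noteq> 0"
    and eq: "s *s (\<gamma> $ a + z $ a *s q) + t *s (\<gamma> $ b + z $ b *s q) = 0"
    using assms(1) by (auto simp: lin_dep_family_pair)
  define k where "k = s * z $ a + t * z $ b"
  have eq': "s *s \<gamma> $ a + t *s \<gamma> $ b + k *s q = 0"
    using eq by (simp add: k_def vec_eq_iff algebra_simps)
  show False
  proof (cases "k = 0")
    case True
    with eq' st assms(1,2) show False by (auto simp: lin_dep_family_pair)
  next
    case False
    then have "q $ i = (- s / k) * \<gamma> $ a $ i + (- t / k) * \<gamma> $ b $ i" for i
      using arg_cong[OF eq', of "\<lambda>v. v $ i"]
      by (simp add: divide_simps) (simp add: algebra_simps eq_neg_iff_add_eq_0)
    then have "q = (- s / k) *s \<gamma> $ a + (- t / k) *s \<gamma> $ b"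
      by (simp add: vec_eq_iff)
    with assms(3) show False unfolding span_pair_iff by blast
  qed
qed

section \<open>Restrictions, dependent triples and lines\<close>

lemma matroid_restrict:
  assumes "matroid M"
  shows "matroid (restrict_matroid M S)"
proof -
  have ground: "ground (restrict_matroid M S) = ground M \<inter> S"
    and indep: "indep (restrict_matroid M S) X \<longleftrightarrow> indep M X \<and> X \<subseteq> S" for X
    by (simp_all add: restrict_matroid_def)
  have fin: "finite (ground M)" and sub: "\<And>X. indep M X \<Longrightarrow> X \<subseteq> ground M"
    and empty: "indep M {}" and down: "\<And>X Y. indep M X \<Longrightarrow> Y \<subseteq> X \<Longrightarrow> indep M Y"
    and exch: "\<And>X Y. indep M X \<Longrightarrow> indep M Y \<Longrightarrow> card X < card Y \<Longrightarrow>
      \<exists>y\<in>Y - X. indep M (insert y X)"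
    using assms by (simp_all add: matroid_def)
  show ?thesis
    unfolding matroid_def ground indep
  proof (intro conjI allI impI; (elim conjE)?)
    fix X Y assume X: "indep M X" "X \<subseteq> S" and Y: "indep M Y" "Y \<subseteq> S" and "card X < card Y"
    then obtain y where "y \<in> Y - X" "indep M (insert y X)"
      using exch by blast
    with X Y show "\<exists>y\<in>Y - X. indep M (insert y X) \<and> insert y X \<subseteq> S" by blast
  qed (use fin sub empty down in auto)
qed

lemma dependent_set_restrict:
  "dependent_set (restrict_matroid M S) X \<longleftrightarrow> dependent_set M X \<and> X \<subseteq> S"
  by (auto simp: dependent_set_def restrict_matroid_def)

lemma simple_matroid_restrict: "simple_matroid M \<Longrightarrow> simple_matroid (restrict_matroid M S)"
  by (auto simp: simple_matroid_def matroid_restrict dependent_set_restrict)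

lemma circuit_variety_restrict: "circuit_variety M \<subseteq> circuit_variety (restrict_matroid M S)"
  by (auto simp: circuit_variety_def dependent_set_restrict)

text \<open>Only triples impose conditions: a dependent set of a simple matroid has at least three
  elements, and four or more vectors in C^3 are always dependent.\<close>

lemma mem_Lift_iff:
  assumes "simple_matroid M"
  shows "z \<in> Lift M q \<gamma> \<longleftrightarrow>
    (\<forall>X. dependent_set M X \<and> card X = 3 \<longrightarrow> lin_dep_family (\<chi> i. \<gamma> $ i + z $ i *s q) X)"
proof -
  have "card X = 3 \<or> card X > 3" if "dependent_set M X" for X
    using assms that by (force simp: simple_matroid_def)
  then show ?thesis
    unfolding Lift_def circuit_variety_def using lin_dep_family_large by blast
qed

lemma dependent_triple_extends_to_line:
  assumes "finite (ground M)" "dependent_set M X" "card X = 3"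
  shows "\<exists>L. is_line M L \<and> X \<subseteq> L"
proof -
  let ?C = "{L. collinear_set M L \<and> X \<subseteq> L}"
  have "X \<subseteq> ground M" using assms(2) by (simp add: dependent_set_def)
  moreover have "Y = X" if "Y \<subseteq> X" "card Y = 3" for Y
    using that assms(3) by (metis card_subset_eq card.infinite zero_neq_numeral)
  \<comment> \<open>The only three-element subset of \<open>X\<close> is \<open>X\<close>
    itself.\<close>
  ultimately have "collinear_set M X"
    using assms by (auto simp: collinear_set_def)
  then have ne: "?C \<noteq> {}" by blast
  have "finite ?C"
    by (rule finite_subset[of _ "Pow (ground M)"]) (use assms(1) in \<open>auto simp: collinear_set_def\<close>)
  from finite_has_maximal[OF this ne] obtain L
    where "L \<in> ?C" "\<forall>L'\<in>?C. L \<subseteq> L' \<longrightarrow> L = L'" by blast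
  \<comment> \<open>Any collinear set above \<open>L\<close> also contains \<open>X\<close>, so
    maximality within \<open>?C\<close> is maximality among all collinear sets.\<close>
  then have "is_line M L \<and> X \<subseteq> L"
    unfolding is_line_def by blast
  then show ?thesis ..
qed

section \<open>Dimension change when a point is deleted\<close>

text \<open>Every vector of \<open>V\<close> is moved into \<open>W\<close> by a multiple of
  \<open>e\<close>, so \<open>V\<close> is the direct sum of \<open>W\<close> and the line through
  \<open>e\<close>.\<close>

lemma dim_eq_Suc_dim:
  assumes "vec.subspace W" "W \<subseteq> V" "e \<in> V" "e \<notin> W" "vec.subspace V"
    and "\<And>v. v \<in> V \<Longrightarrow> \<exists>k. v + k *s e \<in> W"
  shows "vec.dim V = Suc (vec.dim W)"
proof -
  have "V \<subseteq> vec.span (insert e W)"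
  proof
    fix v assume "v \<in> V"
    then obtain k where "v + k *s e \<in> W" using assms(6) by blast
    then have "v - (- k) *s e \<in> vec.span W" by (simp add: vec.span_base)
    then show "v \<in> vec.span (insert e W)" by (unfold vec.span_breakdown_eq) blast
  qed
  moreover have "vec.span (insert e W) \<subseteq> V"
    using assms by (intro vec.span_minimal) auto
  ultimately have "V = vec.span (insert e W)" by blast
  then have "vec.dim V = vec.dim (insert e W)" by (simp only: vec.dim_span)
  also have "\<dots> = Suc (vec.dim W)"
    using assms(1,4) by (simp add: vec.dim_insert vec.span_eq_iff[THEN iffD2])
  finally show ?thesis .
qed

text \<open>The induction step, read as deletion of \<open>x\<close>. Both lifting spaces lie in the
  same C^d: deleting \<open>x\<close> keeps its coordinate but frees it from all conditions, so the
  space can only grow.\<close>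

lemma dim_Lift_delete:
  fixes M :: "'n::finite set_system"
  assumes simple: "simple_matroid M"
    and variety: "\<gamma> \<in> circuit_variety M"
    and distinct: "\<And>i j. i \<noteq> j \<Longrightarrow> \<not> lin_dep_family \<gamma> {i, j}"
    and general: "general_position \<gamma> q"
    and degree: "point_degree M x \<le> 1"
  shows "vec.dim (Lift (restrict_matroid M (- {x})) q \<gamma>) =
    vec.dim (Lift M q \<gamma>) + point_degree M x"
proof -
  let ?N = "restrict_matroid M (- {x})"
  let ?\<delta> = "\<lambda>z. \<chi> i. \<gamma> $ i + z $ i *s q"
  have simpleN: "simple_matroid ?N" using simple by (rule simple_matroid_restrict)
  have varietyN: "\<gamma> \<in> circuit_variety ?N" using variety circuit_variety_restrict by blast
  have fin: "finite (ground M)" by simp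
  have sub: "Lift M q \<gamma> \<subseteq> Lift ?N q \<gamma>"
    by (auto simp: mem_Lift_iff simple simpleN dependent_set_restrict)
  have q: "q \<notin> vec.span {\<gamma> $ a, \<gamma> $ b}" for a b
    using general by (rule general_position_pair)
  have ind: "\<not> lin_dep_family (?\<delta> z) {a, b}" if "a \<noteq> b" for a b z
    using that distinct q by (intro lifted_pair_independent) auto
  consider "point_degree M x = 0" | "point_degree M x = 1" using degree by linarith
  then show ?thesis
  proof cases
    case 1
    then have "\<not> (is_line M L \<and> x \<in> L)" for L
      by (auto simp: point_degree_def)
    \<comment> \<open>A dependent triple containing \<open>x\<close> would extend to a line through
      \<open>x\<close>. So both matroids have the same dependent triples.\<close>
    then have "x \<notin> X" if "dependent_set M X" "card X = 3" for X
      using dependent_triple_extends_to_line[OF fin that] by blast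
    then have "Lift ?N q \<gamma> = Lift M q \<gamma>"
      by (auto simp: mem_Lift_iff simple simpleN dependent_set_restrict)
    with 1 show ?thesis by simp
  next
    case 2
    then obtain L where L: "{L. is_line M L \<and> x \<in> L} = {L}"
      by (auto simp: point_degree_def card_1_singleton_iff)
    then have line: "is_line M L" and x: "x \<in> L" by auto
    have "card L \<ge> 3"
      using line by (simp add: is_line_def collinear_set_def)
    then have "\<not> card (L - {x}) \<le> Suc 0"
      using x by simp
    then obtain a b where ab: "a \<in> L" "b \<in> L" "a \<noteq> x" "b \<noteq> x" "a \<noteq> b"
      by (auto simp: card_le_Suc0_iff_eq)
    have dep: "dependent_set M {a, b, c}" if "c \<in> L" "c \<noteq> a" "c \<noteq> b" for c
      using line that ab by (auto simp: is_line_def collinear_set_def)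
    \<comment> \<open>The triple \<open>{a, b, c}\<close> avoids \<open>x\<close>, so it stays
      dependent after the deletion and constrains \<open>z\<close>.\<close>
    have span: "?\<delta> z $ c \<in> vec.span {?\<delta> z $ a, ?\<delta> z $ b}"
      if "z \<in> Lift ?N q \<gamma>" "c \<in> L" "c \<noteq> x" for z c
    proof (cases "c = a \<or> c = b")
      case True
      then show ?thesis by (auto intro: vec.span_base)
    next
      case False
      then have "dependent_set ?N {a, b, c}"
        using dep ab that by (simp add: dependent_set_restrict)
      then have "lin_dep_family (?\<delta> z) {a, b, c}"
        using that(1) by (simp add: Lift_def circuit_variety_def)
      then show ?thesis
        using ind ab by (intro lin_dep_family_triple_in_span) auto
    qed
    have "lin_dep_family \<gamma> {a, b, x}"
      using variety dep[OF x] ab by (auto simp: circuit_variety_def)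
    then have "\<gamma> $ x \<in> vec.span {\<gamma> $ a, \<gamma> $ b}"
      using distinct ab by (intro lin_dep_family_triple_in_span) auto
    then obtain s t where st: "\<gamma> $ x = s *s \<gamma> $ a + t *s \<gamma> $ b"
      by (auto simp: span_pair_iff)
    have correct: "\<exists>k. z + k *s axis x 1 \<in> Lift M q \<gamma>" if z: "z \<in> Lift ?N q \<gamma>" for z
    proof
      \<comment> \<open>The new \<open>x\<close>-coordinate is \<open>s * z $ a + t * z $ b\<close>,
        so that the lift of \<open>x\<close> satisfies the same linear relation over the lifts of
        \<open>a\<close> and \<open>b\<close> as \<open>\<gamma> $ x\<close> does over
        \<open>\<gamma> $ a\<close> and \<open>\<gamma> $ b\<close>.\<close>
      let ?z = "z + (s * z $ a + t * z $ b - z $ x) *s axis x 1"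
      have other: "?\<delta> ?z $ c = ?\<delta> z $ c" if "c \<noteq> x" for c
        using that by (simp add: axis_def)
      have "?\<delta> ?z $ x = s *s ?\<delta> z $ a + t *s ?\<delta> z $ b"
        by (simp add: st axis_def vec_eq_iff algebra_simps)
      then have "?\<delta> ?z $ x \<in> vec.span {?\<delta> z $ a, ?\<delta> z $ b}"
        unfolding span_pair_iff by blast
      then have in_span: "?\<delta> ?z $ c \<in> vec.span {?\<delta> z $ a, ?\<delta> z $ b}" if "c \<in> L" for c
        using span[OF z that] other by (cases "c = x") auto
      have "lin_dep_family (?\<delta> ?z) X" if X: "dependent_set M X" "card X = 3" for X
      proof (cases "x \<in> X")
        case True
        \<comment> \<open>The line extending \<open>X\<close> passes through \<open>x\<close>, hence
          is \<open>L\<close>. Three vectors in a span of two are then dependent.\<close>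
        then have "X \<subseteq> L"
          using dependent_triple_extends_to_line[OF fin X] L by blast
        moreover have "card {?\<delta> z $ a, ?\<delta> z $ b} < card X"
          using X(2) by (simp add: card_insert_if)
        ultimately show ?thesis
          using in_span by (intro lin_dep_family_in_span[of "{?\<delta> z $ a, ?\<delta> z $ b}"]) auto
      next
        case False
        then have "lin_dep_family (?\<delta> z) X"
          using z X by (simp add: mem_Lift_iff[OF simpleN] dependent_set_restrict)
        moreover have "lin_dep_family (?\<delta> ?z) X \<longleftrightarrow> lin_dep_family (?\<delta> z) X"
          using False by (intro lin_dep_family_cong other) auto
        ultimately show ?thesis by simp
      qed
      then show "?z \<in> Lift M q \<gamma>"
        by (simp only: mem_Lift_iff[OF simple]) blast
    qed
    have axis_other: "?\<delta> (axis x 1) $ c = \<gamma> $ c" if "c \<noteq> x" for c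
      using that by (simp add: axis_def)
    \<comment> \<open>This lift moves only \<open>x\<close>, which occurs in no dependent set of
      \<open>?N\<close>.\<close>
    have "axis x 1 \<in> Lift ?N q \<gamma>"
      unfolding mem_Lift_iff[OF simpleN]
    proof (intro allI impI, elim conjE)
      fix X assume X: "dependent_set ?N X" "card X = 3"
      then have "lin_dep_family (?\<delta> (axis x 1)) X \<longleftrightarrow> lin_dep_family \<gamma> X"
        by (intro lin_dep_family_cong axis_other) (auto simp: dependent_set_restrict)
      then show "lin_dep_family (?\<delta> (axis x 1)) X"
        using varietyN X by (simp add: circuit_variety_def)
    qed
    \<comment> \<open>Here \<open>a\<close> and \<open>b\<close> stay fixed while \<open>x\<close>
      moves by \<open>q\<close>. Membership would put \<open>\<gamma> $ x + q\<close>, and hence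
      \<open>q\<close>, into the plane of \<open>a\<close> and \<open>b\<close>.\<close>
    moreover have "axis x 1 \<notin> Lift M q \<gamma>"
    proof
      assume "axis x 1 \<in> Lift M q \<gamma>"
      then have "lin_dep_family (?\<delta> (axis x 1)) {a, b, x}"
        using dep[OF x] ab by (simp add: Lift_def circuit_variety_def)
      then have "?\<delta> (axis x 1) $ x \<in> vec.span {?\<delta> (axis x 1) $ a, ?\<delta> (axis x 1) $ b}"
        using ind[OF ab(5)] by (rule lin_dep_family_triple_in_span)
      then have "\<gamma> $ x + q \<in> vec.span {\<gamma> $ a, \<gamma> $ b}"
        unfolding axis_other[OF ab(3)] axis_other[OF ab(4)] by simp
      from vec.span_diff[OF this \<open>\<gamma> $ x \<in> _\<close>] q show False by simp
    qed
    ultimately have "vec.dim (Lift ?N q \<gamma>) = Suc (vec.dim (Lift M q \<gamma>))"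
      using sub correct simple simpleN variety varietyN
      by (intro dim_eq_Suc_dim[where e = "axis x 1"] subspace_Lift)
    with 2 show ?thesis by simp
  qed
qed

section \<open>Induction along the ordering\<close>

theorem theorem4p4:
  fixes M :: "'n::finite set_system"
    and p :: "nat \<Rightarrow> 'n"
    and w :: "nat \<Rightarrow> nat"
    and \<gamma> :: "complex ^ 3 ^ 'n"
    and q :: "complex ^ 3"
  assumes ground: "ground M = UNIV"
    and simple: "simple_matroid M"
    and rank: "matroid_rank M = 3"
    and nilpotent: "nilpotent_matroid M"
    and ordering: "bij_betw p {1..CARD('n)} UNIV"
    and w_def: "\<And>i. i \<in> {1..CARD('n)} \<Longrightarrow> w i = order_degree M p i"
    and w_le: "\<And>i. i \<in> {1..CARD('n)} \<Longrightarrow> w i \<le> 1"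
    and in_variety: "\<gamma> \<in> circuit_variety M"
    and no_loops: "\<And>i. \<gamma> $ i \<noteq> 0"
    and no_coinciding: "\<And>i j. i \<noteq> j \<Longrightarrow> \<not> lin_dep_family \<gamma> {i, j}"
    and general: "general_position \<gamma> q"
  shows "int (vec.dim (Lift M q \<gamma>)) = int CARD('n) - (\<Sum>i = 1..CARD('n). int (w i))"
proof -
  let ?M = "\<lambda>i. restrict_matroid M (p ` {1..i})"
  \<comment> \<open>The invariant is a sum rather than a difference, which avoids truncated
    subtraction. The total is d at every stage because all restrictions share the index type
    \<open>'n\<close>.\<close>
  have "vec.dim (Lift (?M m) q \<gamma>) + (\<Sum>i = 1..m. w i) = CARD('n)" if "m \<le> CARD('n)" for m
    using that
  proof (induction m)
    case 0
    have "indep M {}"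
      using simple unfolding simple_matroid_def matroid_def by blast
    \<comment> \<open>With no points inserted, the only candidate is the empty set, which is
      independent; so nothing constrains the lift.\<close>
    then have "\<not> dependent_set (?M 0) X" for X
      by (auto simp: dependent_set_def restrict_matroid_def)
    then have "Lift (?M 0) q \<gamma> = UNIV"
      by (simp add: Lift_def circuit_variety_def)
    then show ?case by (simp add: vec.dim_UNIV vec.dimension_def card_cart_basis)
  next
    case (Suc m)
    have "inj_on p {1..CARD('n)}" using ordering by (simp add: bij_betw_def)
    then have "p (Suc m) \<notin> p ` {1..m}"
      using Suc.prems by (auto dest: inj_onD)
    then have "p ` {1..m} = p ` {1..Suc m} \<inter> - {p (Suc m)}"
      by (subst atLeastAtMostSuc_conv) (simp, blast)
    \<comment> \<open>Since \<open>p (Suc m)\<close> is new, deleting it from stage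
      \<open>Suc m\<close> gives back stage \<open>m\<close>.\<close>
    then have del: "restrict_matroid (?M (Suc m)) (- {p (Suc m)}) = ?M m"
      by (simp add: restrict_matroid_def ground)
    have w: "w (Suc m) = point_degree (?M (Suc m)) (p (Suc m))"
      using w_def Suc.prems by (simp add: order_degree_def)
    have "vec.dim (Lift (?M m) q \<gamma>) = vec.dim (Lift (?M (Suc m)) q \<gamma>) + w (Suc m)"
      unfolding del[symmetric] w
      using simple in_variety no_coinciding general w w_le[of "Suc m"] Suc.prems
      by (intro dim_Lift_delete simple_matroid_restrict circuit_variety_restrict[THEN subsetD]) auto
    with Suc show ?case by simp
  qed
  moreover have "?M (CARD('n)) = M"
    using ordering ground by (cases M) (simp add: bij_betw_def restrict_matroid_def)
  ultimately have "vec.dim (Lift M q \<gamma>) + (\<Sum>i = 1..CARD('n). w i) = CARD('n)"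
    by (metis order_refl)
  then show ?thesis by (simp flip: of_nat_sum of_nat_add)
qed

end
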